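(* Let $\mathbf{H}_j\in\mathbb{H}^{n_j}(\mathbb{R}^2)$, $1\le j\le p$, be harmonic tensors with $n_j\ge1$, and write $\phi(\mathbf{H}_j)=\mathrm{Re}(\overline{z}_jz^{n_j})$ with $z_j\in\mathbb{C}$, $z=x+iy$. Then $$\mathrm{Re}\left(\overline{z}_1\cdots\overline{z}_p\,z^{n_1+\dots+n_p}\right)=2^{p-1}\,\phi\left((\mathbf{H}_1\odot\dots\odot\mathbf{H}_p)'\right).$$
   Context: $\mathbb{S}^n(\mathbb{R}^2)$ is the space of totally symmetric tensors of order $n$ on Euclidean $\mathbb{R}^2$; $\mathbb{H}^n(\mathbb{R}^2)$ is its subspace of harmonic (traceless) tensors. $\phi(\mathbf{S})(\mathbf{x})=\mathbf{S}(\mathbf{x},\dots,\mathbf{x})$, $\mathbf{x}=(x,y)$, is the bijection between $\mathbb{S}^n(\mathbb{R}^2)$ and homogeneous polynomials of degree $n$; harmonic tensors correspond to harmonic polynomials, each of which is $\mathrm{Re}(\overline{z}_jz^{n})$ for a unique $z_j\in\mathbb{C}$. $\mathbf{S}_1\odot\mathbf{S}_2=(\mathbf{S}_1\otimes\mathbf{S}_2)^s$ is the symmetrized tensor product (corresponding to the product of polynomials). For $\mathbf{S}\in\mathbb{S}^n(\mathbb{R}^2)$, $\mathbf{S}'\in\mathbb{H}^n(\mathbb{R}^2)$ is its leading harmonic part: $\phi(\mathbf{S}')=\mathrm{h}_0$ in the unique decomposition $\phi(\mathbf{S})=\mathrm{h}_0+\mathrm{q}\,\mathrm{h}_1+\dots+\mathrm{q}^r\mathrm{h}_r$,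 $r=\lfloor n/2\rfloor$, $\mathrm{q}=x^2+y^2$, with $\mathrm{h}_k$ homogeneous harmonic of degree $n-2k$. *)

theory Defs
  imports "HOL-Analysis.Analysis" "HOL-Combinatorics.Permutations"
begin

text \<open>
  A tensor of order \<open>n\<close> on the Euclidean plane is an \<open>n\<close>-linear form. Its arguments are the
  values at \<open>0, \<dots>, n - 1\<close> of a sequence of vectors, the rest of which has to be irrelevant; this
  way all orders live in one type, and equality of tensors is equality of functions.
\<close>

type_synonym tensor = "(nat \<Rightarrow> real^2) \<Rightarrow> real"

definition is_tensor :: "nat \<Rightarrow> tensor \<Rightarrow> bool" where
  "is_tensor n T \<longleftrightarrow>
     (\<forall>u v. (\<forall>i<n. u i = v i) \<longrightarrow> T u = T v) \<and>
     (\<forall>u. \<forall>i<n. linear (\<lambda>a. T (u(i := a))))"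

definition sym_tensors :: "nat \<Rightarrow> tensor set" where
  "sym_tensors n = {T. is_tensor n T \<and> (\<forall>\<sigma> u. \<sigma> permutes {..<n} \<longrightarrow> T (u \<circ> \<sigma>) = T u)}"

definition harm_tensors :: "nat \<Rightarrow> tensor set" where
  "harm_tensors n = {T \<in> sym_tensors n.
     \<forall>u. \<forall>i<n. \<forall>j<n. i \<noteq> j \<longrightarrow>
       (\<Sum>k\<in>(UNIV :: 2 set). T (u(i := axis k 1, j := axis k 1))) = 0}"

definition phi :: "tensor \<Rightarrow> real^2 \<Rightarrow> real" where
  "phi T x = T (\<lambda>_. x)"

definition tensor_prod :: "nat \<Rightarrow> tensor \<Rightarrow> tensor \<Rightarrow> tensor" where
  "tensor_prod m S T = (\<lambda>u. S u * T (\<lambda>i. u (m + i)))"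

definition symmetrize :: "nat \<Rightarrow> tensor \<Rightarrow> tensor" where
  "symmetrize n T = (\<lambda>u. (\<Sum>\<sigma> | \<sigma> permutes {..<n}. T (u \<circ> \<sigma>)) / fact n)"

definition sym_prod :: "nat \<Rightarrow> nat \<Rightarrow> tensor \<Rightarrow> tensor \<Rightarrow> tensor" where
  "sym_prod m n S T = symmetrize (m + n) (tensor_prod m S T)"

text \<open>
  \<open>sym_prods n H p\<close> is the product \<open>H 1 \<odot> \<dots> \<odot> H p\<close>, bracketed to the left, where
  \<open>H j\<close> has order \<open>n j\<close>.
\<close>

fun sym_prods :: "(nat \<Rightarrow> nat) \<Rightarrow> (nat \<Rightarrow> tensor) \<Rightarrow> nat \<Rightarrow> tensor" where
  "sym_prods n H 0 = (\<lambda>_. 1)"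
| "sym_prods n H (Suc 0) = H 1"
| "sym_prods n H (Suc (Suc k)) =
     sym_prod (\<Sum>j=1..Suc k. n j) (n (Suc (Suc k))) (sym_prods n H (Suc k)) (H (Suc (Suc k)))"

text \<open>Polynomials in two real variables are identified with the functions they induce on the plane.\<close>

definition hom_polys :: "nat \<Rightarrow> (real^2 \<Rightarrow> real) set" where
  "hom_polys n = {f. \<exists>c. \<forall>x. f x = (\<Sum>i\<le>n. c i * (x $ 1) ^ i * (x $ 2) ^ (n - i))}"

definition laplacian :: "(real^2 \<Rightarrow> real) \<Rightarrow> real^2 \<Rightarrow> real" where
  "laplacian f x = (\<Sum>k\<in>(UNIV :: 2 set). deriv (deriv (\<lambda>t. f (x + t *\<^sub>R axis k 1))) 0)"

definition harm_polys :: "nat \<Rightarrow> (real^2 \<Rightarrow> real) set" where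
  "harm_polys n = {f \<in> hom_polys n. \<forall>x. laplacian f x = 0}"

definition harm_decomp :: "nat \<Rightarrow> (real^2 \<Rightarrow> real) \<Rightarrow> (nat \<Rightarrow> real^2 \<Rightarrow> real) \<Rightarrow> bool" where
  "harm_decomp n f h \<longleftrightarrow>
     (\<forall>k \<le> n div 2. h k \<in> harm_polys (n - 2 * k)) \<and>
     (\<forall>x. f x = (\<Sum>k\<le>n div 2. ((x $ 1)\<^sup>2 + (x $ 2)\<^sup>2) ^ k * h k x))"

definition leading_harm :: "nat \<Rightarrow> tensor \<Rightarrow> tensor" where
  "leading_harm n S =
     (THE T. T \<in> harm_tensors n \<and> (\<exists>h. harm_decomp n (phi S) h \<and> phi T = h 0))"

end

theory Submission imports Defs begin

text \<open>
  In the plane a product of two harmonic polynomials is understood through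
  \<open>Re A * Re B = (Re (A * B) + Re (A * cnj B)) / 2\<close>. For \<open>A = a * w ^ m\<close> and
  \<open>B = b * w ^ n\<close> the first summand is \<open>Re (a * b / 2 * w ^ (m + n))\<close>, while in the second one
  pairs \<open>w * cnj w = q\<close> can be split off, which leaves \<open>q ^ min m n\<close> times a harmonic polynomial.
  So each factor beyond the first multiplies the leading coefficient by \<open>cnj (z j) / 2\<close> and
  pushes everything else into multiples of \<open>q\<close>; after \<open>p\<close> factors the leading part is
  \<open>Re (cnj (z 1) \<dots> cnj (z p) * w ^ N) / 2 ^ (p - 1)\<close>, with \<open>N\<close> the total degree
  (\<open>sym_prods_expansion\<close>). The symmetrized product of tensors enters only through \<open>phi\<close>, under
  which it is the product of polynomials.

  It remains to see that the description defining the leading harmonic part has exactly one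
  solution, a tensor with that polynomial. This rests on two facts. Every harmonic tensor of
  positive order is \<open>Re (c * u\<^sub>0 * \<dots> * u\<^sub>n\<^sub>-\<^sub>1)\<close> for some complex \<open>c\<close>, its arguments being
  read as complex numbers (\<open>harm_tensor_is_harm_form\<close>). And \<open>c\<close> is determined by the polynomial to be
  decomposed (\<open>leading_coeff_unique\<close>): all other summands of a harmonic decomposition are divisible
  by \<open>q\<close>, hence vanish at the complex point \<open>(1, \<i>)\<close>, where
  \<open>Re (c * (x + \<i> * y) ^ n) = (c * (x + \<i> * y) ^ n + cnj c * (x - \<i> * y) ^ n) / 2\<close>
  takes the value \<open>cnj c / 2 * 2 ^ n\<close>.
\<close>

section \<open>Harmonic tensors of the plane\<close>

definition to_complex :: "real^2 \<Rightarrow> complex" where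
  "to_complex x = Complex (x $ 1) (x $ 2)"

abbreviation sqnorm :: "real^2 \<Rightarrow> real" where
  "sqnorm x \<equiv> (x $ 1)\<^sup>2 + (x $ 2)\<^sup>2"

definition harm_form :: "nat \<Rightarrow> complex \<Rightarrow> tensor" where
  "harm_form n c u = Re (c * (\<Prod>i<n. to_complex (u i)))"

abbreviation e1 :: "real^2" where "e1 \<equiv> axis 1 1"
abbreviation e2 :: "real^2" where "e2 \<equiv> axis 2 1"

text \<open>
  Real parts of products are manipulated as wholes below; splitting them into coordinates on sight
  would hide the complex factorizations that the arguments depend on.
\<close>

declare times_complex.sel [simp del]

lemma Re_of_real_mult: "Re (of_real r * w) = r * Re w"
  by (simp add: times_complex.sel)

lemma to_complex_basis [simp]: "to_complex e1 = 1" "to_complex e2 = \<i>"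
  by (simp_all add: to_complex_def axis_def complex_eq_iff)

lemma to_complex_add [simp]: "to_complex (x + y) = to_complex x + to_complex y"
  and to_complex_scaleR [simp]: "to_complex (r *\<^sub>R x) = of_real r * to_complex x"
  by (simp_all add: to_complex_def complex_eq_iff times_complex.sel)

lemma of_real_sqnorm: "complex_of_real (sqnorm x) = to_complex x * cnj (to_complex x)"
  by (simp add: to_complex_def complex_eq_iff power2_eq_square times_complex.sel)

lemma phi_harm_form: "phi (harm_form n c) x = Re (c * to_complex x ^ n)"
  by (simp add: phi_def harm_form_def)

lemma prod_fun_upd:
  fixes f :: "'b \<Rightarrow> 'c::comm_monoid_mult"
  assumes "i < (n::nat)"
  shows "(\<Prod>k<n. f ((u(i := a)) k)) = f a * (\<Prod>k\<in>{..<n} - {i}. f (u k))"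
proof -
  have "(\<Prod>k<n. f ((u(i := a)) k)) = f ((u(i := a)) i) * (\<Prod>k\<in>{..<n} - {i}. f ((u(i := a)) k))"
    using assms by (intro prod.remove) auto
  also have "(\<Prod>k\<in>{..<n} - {i}. f ((u(i := a)) k)) = (\<Prod>k\<in>{..<n} - {i}. f (u k))"
    by (intro prod.cong) auto
  finally show ?thesis by simp
qed

lemma prod_fun_upd2:
  fixes f :: "'b \<Rightarrow> 'c::comm_monoid_mult"
  assumes "i < (n::nat)" "j < n" "i \<noteq> j"
  shows "(\<Prod>k<n. f ((u(i := a, j := b)) k)) = f a * f b * (\<Prod>k\<in>{..<n} - {i} - {j}. f (u k))"
proof -
  have "(\<Prod>k<n. f ((u(i := a, j := b)) k)) = f b * (\<Prod>k\<in>{..<n} - {j}. f ((u(i := a)) k))"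
    using assms by (simp only: prod_fun_upd)
  also have "(\<Prod>k\<in>{..<n} - {j}. f ((u(i := a)) k))
      = f ((u(i := a)) i) * (\<Prod>k\<in>{..<n} - {j} - {i}. f ((u(i := a)) k))"
    using assms by (intro prod.remove) auto
  also have "(\<Prod>k\<in>{..<n} - {j} - {i}. f ((u(i := a)) k)) = (\<Prod>k\<in>{..<n} - {i} - {j}. f (u k))"
    by (intro prod.cong) auto
  finally show ?thesis by (simp only: fun_upd_same mult_ac)
qed

text \<open>
  The form is traceless because its trace over two slots carries the factor
  \<open>1 * 1 + \<i> * \<i> = 0\<close>.
\<close>

lemma harm_form_harm: "harm_form n c \<in> harm_tensors n"
proof -
  have "is_tensor n (harm_form n c)"
    unfolding is_tensor_def
  proof (intro conjI allI impI)
    fix u v :: "nat \<Rightarrow> real^2" assume "\<forall>i<n. u i = v i"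
    then show "harm_form n c u = harm_form n c v"
      unfolding harm_form_def by (metis (mono_tags, lifting) lessThan_iff prod.cong)
  next
    fix u :: "nat \<Rightarrow> real^2" and i assume "i < n"
    then have "harm_form n c (u(i := a))
        = Re (c * (to_complex a * (\<Prod>k\<in>{..<n} - {i}. to_complex (u k))))" for a
      by (simp only: harm_form_def prod_fun_upd)
    then show "linear (\<lambda>a. harm_form n c (u(i := a)))"
      by (intro linearI)
        (simp_all add: distrib_left distrib_right mult.left_commute[of c] mult.assoc Re_of_real_mult)
  qed
  moreover have "harm_form n c (u \<circ> s) = harm_form n c u" if "s permutes {..<n}" for s u
    using prod.permute[OF that, of "\<lambda>i. to_complex (u i)"] by (simp add: harm_form_def o_def)
  moreover have "(\<Sum>k\<in>(UNIV :: 2 set). harm_form n c (u(i := axis k 1, j := axis k 1))) = 0"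
    if "i < n" "j < n" "i \<noteq> j" for u i j
    unfolding harm_form_def prod_fun_upd2[OF that] by (simp add: UNIV_2)
  ultimately show ?thesis by (auto simp: harm_tensors_def sym_tensors_def)
qed

text \<open>
  Multilinearity frees the slots one after the other: the induction below lets the first \<open>k\<close>
  arguments be arbitrary and restricts the others to basis vectors.
\<close>

lemma tensor_eq_on_basis:
  assumes S: "is_tensor n S" and T: "is_tensor n T"
    and basis: "\<And>u. (\<And>i. i < n \<Longrightarrow> u i \<in> {e1, e2}) \<Longrightarrow> S u = T u"
  shows "S = T"
proof -
  have split: "R u = (u k $ 1) * R (u(k := e1)) + (u k $ 2) * R (u(k := e2))"
    if R: "is_tensor n R" and k: "k < n" for R u k
  proof -
    have lin: "linear (\<lambda>a. R (u(k := a)))" using R k by (simp add: is_tensor_def)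
    have "u k = (u k $ 1) *\<^sub>R e1 + (u k $ 2) *\<^sub>R e2"
      by (simp add: vec_eq_iff axis_def forall_2)
    then have "R (u(k := u k)) = R (u(k := (u k $ 1) *\<^sub>R e1 + (u k $ 2) *\<^sub>R e2))" by simp
    then show ?thesis
      by (simp add: linear_add[OF lin] linear_scale[OF lin])
  qed
  have "\<forall>u. (\<forall>i. k \<le> i \<and> i < n \<longrightarrow> u i \<in> {e1, e2}) \<longrightarrow> S u = T u" if "k \<le> n" for k
    using that
  proof (induction k)
    case 0
    then show ?case using basis by auto
  next
    case (Suc k)
    show ?case
    proof (intro allI impI)
      fix u :: "nat \<Rightarrow> real^2" assume u: "\<forall>i. Suc k \<le> i \<and> i < n \<longrightarrow> u i \<in> {e1, e2}"
      have *: "S (u(k := b)) = T (u(k := b))" if "b \<in> {e1, e2}" for b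
      proof -
        have "(u(k := b)) i \<in> {e1, e2}" if "k \<le> i" "i < n" for i
          using u \<open>b \<in> {e1, e2}\<close> that by (cases "i = k") auto
        then show ?thesis using Suc by simp
      qed
      have k: "k < n" using Suc.prems by simp
      show "S u = T u"
        using split[OF S k, of u] split[OF T k, of u] *[of e1] *[of e2] by simp
    qed
  qed
  from this[of n] show ?thesis by (intro ext) auto
qed

text \<open>
  Tracelessness trades two entries \<open>e2\<close> for two entries \<open>e1\<close> at the cost of a sign, so on basis
  vectors at most one \<open>e2\<close> has to be considered, and by symmetry it may stand in the first slot.
\<close>

lemma harm_tensor_eqI:
  assumes S: "S \<in> harm_tensors n" and T: "T \<in> harm_tensors n"
    and eq1: "S (\<lambda>_. e1) = T (\<lambda>_. e1)"
    and eq2: "S ((\<lambda>_. e1)(0 := e2)) = T ((\<lambda>_. e1)(0 := e2))"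
  shows "S = T"
proof (rule tensor_eq_on_basis[of n])
  show "is_tensor n S" "is_tensor n T"
    using S T by (auto simp: harm_tensors_def sym_tensors_def)
next
  have loc: "R u = R v" if "R \<in> harm_tensors n" "\<And>i. i < n \<Longrightarrow> u i = v i" for R u v
    using that by (auto simp: harm_tensors_def sym_tensors_def is_tensor_def)
  have first: "R ((\<lambda>_. e1)(i := e2)) = R ((\<lambda>_. e1)(0 := e2))"
    if R: "R \<in> harm_tensors n" and i: "i < n" for R i
  proof -
    have "Transposition.transpose 0 i permutes {..<n}" using i by (intro permutes_swap_id) auto
    then have "R (((\<lambda>_. e1)(0 := e2)) \<circ> Transposition.transpose 0 i) = R ((\<lambda>_. e1)(0 := e2))"
      using R unfolding harm_tensors_def sym_tensors_def by blast
    moreover have "((\<lambda>_. e1)(0 := e2)) \<circ> Transposition.transpose 0 i = (\<lambda>_. e1)(i := e2)"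
      by (auto simp: Transposition.transpose_def fun_eq_iff)
    ultimately show ?thesis by simp
  qed
  have trace: "R u = - R (u(i := e1, j := e1))"
    if R: "R \<in> harm_tensors n" and ij: "i < n" "j < n" "i \<noteq> j" "u i = e2" "u j = e2" for R u i j
  proof -
    have "(\<Sum>k\<in>(UNIV :: 2 set). R (u(i := axis k 1, j := axis k 1))) = 0"
      using R ij unfolding harm_tensors_def by blast
    moreover have "u(i := e2, j := e2) = u" using ij by (metis fun_upd_triv)
    ultimately show ?thesis by (simp add: UNIV_2)
  qed
  fix u :: "nat \<Rightarrow> real^2" assume "\<And>i. i < n \<Longrightarrow> u i \<in> {e1, e2}"
  then show "S u = T u"
  proof (induction "card {i. i < n \<and> u i = e2}" arbitrary: u rule: less_induct)
    case less
    let ?A = "\<lambda>u. {i. i < n \<and> u i = e2}"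
    have fin: "finite (?A u)" for u by simp
    have ne: "e1 \<noteq> e2" by (simp add: axis_eq_axis)
    consider "?A u = {}" | i where "?A u = {i}" | i j where "i \<in> ?A u" "j \<in> ?A u" "i \<noteq> j"
      by blast
    then show ?case
    proof cases
      case 1
      then have "\<And>i. i < n \<Longrightarrow> u i = e1" using less.prems by blast
      then show ?thesis using loc[OF S, of u "\<lambda>_. e1"] loc[OF T, of u "\<lambda>_. e1"] eq1 by simp
    next
      case 2
      have "u k = ((\<lambda>_. e1)(i := e2)) k" if "k < n" for k
        using 2 less.prems[OF that] that by (cases "k = i") auto
      moreover have "i < n" using 2 by auto
      ultimately show ?thesis
        using loc[OF S, of u "(\<lambda>_. e1)(i := e2)"] loc[OF T, of u "(\<lambda>_. e1)(i := e2)"]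
          first[OF S, of i] first[OF T, of i] eq2 by simp
    next
      case 3
      let ?v = "u(i := e1, j := e1)"
      have "?A ?v \<subset> ?A u" using 3 ne by auto
      then have "card (?A ?v) < card (?A u)" by (rule psubset_card_mono[OF fin])
      moreover have "?v k \<in> {e1, e2}" if "k < n" for k
        using less.prems[OF that] by auto
      ultimately have "S ?v = T ?v" by (rule less.hyps)
      then show ?thesis using 3 trace[OF S, of i j u] trace[OF T, of i j u] by simp
    qed
  qed
qed

lemma harm_tensor_is_harm_form:
  assumes "T \<in> harm_tensors n" "1 \<le> n"
  obtains c where "T = harm_form n c"
proof -
  \<comment> \<open>This makes \<open>Re ?c\<close> and \<open>Re (?c * \<i>)\<close> the values that \<open>T\<close> takes in \<open>harm_tensor_eqI\<close>.\<close>
  let ?c = "Complex (T (\<lambda>_. e1)) (- T ((\<lambda>_. e1)(0 := e2)))"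
  have "T = harm_form n ?c"
  proof (rule harm_tensor_eqI[OF assms(1) harm_form_harm])
    show "T (\<lambda>_. e1) = harm_form n ?c (\<lambda>_. e1)" by (simp add: harm_form_def)
    have "(\<Prod>i<n. to_complex (((\<lambda>_. e1)(0 := e2)) i)) = \<i>"
      using assms(2) by (subst prod_fun_upd) auto
    then show "T ((\<lambda>_. e1)(0 := e2)) = harm_form n ?c ((\<lambda>_. e1)(0 := e2))"
      by (simp only: harm_form_def) (simp add: times_complex.sel)
  qed
  then show ?thesis by (rule that)
qed

section \<open>Harmonic polynomials and harmonic decompositions\<close>

lemma Re_power_in_hom_polys: "(\<lambda>x. Re (c * to_complex x ^ n)) \<in> hom_polys n"
proof -
  have "Re (c * to_complex x ^ n)
      = (\<Sum>k\<le>n. Re (c * of_nat (n choose k) * \<i> ^ (n - k)) * (x $ 1) ^ k * (x $ 2) ^ (n - k))" for x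
  proof -
    have "to_complex x = of_real (x $ 1) + \<i> * of_real (x $ 2)"
      by (simp add: to_complex_def complex_eq_iff)
    then have "c * to_complex x ^ n
        = (\<Sum>k\<le>n. c * of_nat (n choose k) * \<i> ^ (n - k) * of_real ((x $ 1) ^ k * (x $ 2) ^ (n - k)))"
      by (simp add: binomial_ring sum_distrib_left power_mult_distrib mult_ac)
    then show ?thesis
      by (simp add: Re_sum mult.commute[of _ "of_real _"] Re_of_real_mult del: of_real_mult of_real_power)
         (simp add: mult_ac)
  qed
  then show ?thesis by (auto simp: hom_polys_def)
qed

lemma deriv_Re_power:
  "deriv (\<lambda>t. Re (c * (w + of_real t * a) ^ n))
     = (\<lambda>t. Re (c * of_nat n * a * (w + of_real t * a) ^ (n - 1)))"
proof
  fix t :: real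
  have "((\<lambda>s. c * (w + s * a) ^ n) has_field_derivative
      c * of_nat n * a * (w + of_real t * a) ^ (n - 1)) (at (of_real t))"
    by (auto intro!: derivative_eq_intros)
  then have "((\<lambda>t. c * (w + of_real t * a) ^ n) has_vector_derivative
      c * of_nat n * a * (w + of_real t * a) ^ (n - 1)) (at t)"
    by (rule has_vector_derivative_real_field)
  then have "((\<lambda>t. Re (c * (w + of_real t * a) ^ n)) has_field_derivative
      Re (c * of_nat n * a * (w + of_real t * a) ^ (n - 1))) (at t)"
    by (rule has_field_derivative_Re)
  then show "deriv (\<lambda>t. Re (c * (w + of_real t * a) ^ n)) t
      = Re (c * of_nat n * a * (w + of_real t * a) ^ (n - 1))"
    by (rule DERIV_imp_deriv)
qed

text \<open>
  The second derivatives in the directions \<open>1\<close> and \<open>\<i>\<close> differ by the factor \<open>\<i> ^ 2 = - 1\<close>.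
\<close>

lemma Re_power_in_harm_polys: "(\<lambda>x. Re (c * to_complex x ^ n)) \<in> harm_polys n"
proof -
  have "laplacian (\<lambda>x. Re (c * to_complex x ^ n)) x = 0" for x
    unfolding laplacian_def UNIV_2
    by (simp add: deriv_Re_power flip: mult.assoc) (simp add: mult.assoc mult.left_commute[of \<i>])
  then show ?thesis using Re_power_in_hom_polys by (simp add: harm_polys_def)
qed

text \<open>
  A harmonic decomposition given by the complex coefficients of its parts. In this form it can be
  computed with, and its leading part is read off from \<open>c 0\<close>.
\<close>

definition harm_expansion :: "nat \<Rightarrow> (real^2 \<Rightarrow> real) \<Rightarrow> (nat \<Rightarrow> complex) \<Rightarrow> bool" where
  "harm_expansion n f c \<longleftrightarrow>
     (\<forall>x. f x = (\<Sum>k\<le>n div 2. sqnorm x ^ k * Re (c k * to_complex x ^ (n - 2 * k))))"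

lemma harm_decomp_of_expansion:
  assumes "harm_expansion n f c"
  shows "harm_decomp n f (\<lambda>k x. Re (c k * to_complex x ^ (n - 2 * k)))"
  using assms by (simp add: harm_decomp_def harm_expansion_def Re_power_in_harm_polys)

text \<open>
  The last summand comes from \<open>A * cnj B\<close>, or its conjugate if \<open>m < n\<close>; the coefficient \<open>e\<close> is
  left unspecified because only the power of \<open>q\<close> in front of it matters for the leading part.
\<close>

lemma Re_power_mult_Re_power:
  "\<exists>e. \<forall>x. Re (a * to_complex x ^ m) * Re (b * to_complex x ^ n)
     = Re (a * b / 2 * to_complex x ^ (m + n))
       + sqnorm x ^ min m n * Re (e * to_complex x ^ (m + n - 2 * min m n))"
proof -
  have *: "Re (a * to_complex x ^ m) * Re (b * to_complex x ^ n)
     = Re (a * b / 2 * to_complex x ^ (m + n))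
       + sqnorm x ^ n * Re (a * cnj b / 2 * to_complex x ^ (m - n))"
    if "n \<le> m" for a b m n x
  proof -
    let ?w = "to_complex x"
    let ?A = "a * ?w ^ m" and ?B = "b * ?w ^ n"
    have "Re A * Re B = Re (A * B / 2) + Re (A * cnj B / 2)" for A B
      by (simp add: times_complex.sel field_simps)
    moreover have "?A * ?B / 2 = a * b / 2 * ?w ^ (m + n)" by (simp add: power_add)
    moreover have "?w ^ m = ?w ^ (m - n) * ?w ^ n" using that by (simp flip: power_add)
    then have "?A * cnj ?B / 2 = of_real (sqnorm x ^ n) * (a * cnj b / 2 * ?w ^ (m - n))"
      by (simp only: of_real_power of_real_sqnorm) (simp add: power_mult_distrib)
    ultimately show ?thesis by (simp only: Re_of_real_mult)
  qed
  show ?thesis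
  proof (cases "n \<le> m")
    case True
    then have "min m n = n" "m + n - 2 * min m n = m - n" by auto
    then show ?thesis using *[OF True] by (intro exI[of _ "a * cnj b / 2"]) (simp only: simp_thms)
  next
    case False
    then have "min m n = m" "m + n - 2 * min m n = n - m" "m \<le> n" by auto
    then show ?thesis
      using *[of m n b _ a] by (intro exI[of _ "b * cnj a / 2"]) (simp only: mult.commute add.commute simp_thms)
  qed
qed

text \<open>
  Each summand of the expansion of \<open>f\<close> contributes to two summands of the product, at \<open>k\<close> and at
  \<open>k + min (m - 2 * k) n\<close>. The latter index is never \<open>0\<close>, as both degrees are positive, so
  \<open>d 0\<close> receives a contribution only from \<open>c 0\<close>, and only half of the product.
\<close>

lemma harm_expansion_mult:
  assumes f: "harm_expansion m f c" and m: "1 \<le> m" and n: "1 \<le> n"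
  shows "\<exists>d. harm_expansion (m + n) (\<lambda>x. f x * Re (b * to_complex x ^ n)) d \<and> d 0 = c 0 * b / 2"
proof -
  let ?t = "\<lambda>k x. sqnorm x ^ k * Re (c k * to_complex x ^ (m - 2 * k))"
  define Q where "Q k d \<longleftrightarrow> harm_expansion (m + n) (\<lambda>x. ?t k x * Re (b * to_complex x ^ n)) d
          \<and> d 0 = (if k = 0 then c 0 * b / 2 else 0)" for k d
  have "\<exists>d. Q k d" if k: "k \<le> m div 2" for k
  proof -
    define \<mu> where "\<mu> = min (m - 2 * k) n"
    obtain e where e: "\<And>x. Re (c k * to_complex x ^ (m - 2 * k)) * Re (b * to_complex x ^ n)
       = Re (c k * b / 2 * to_complex x ^ (m - 2 * k + n))
         + sqnorm x ^ \<mu> * Re (e * to_complex x ^ (m - 2 * k + n - 2 * \<mu>))"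
      unfolding \<mu>_def using Re_power_mult_Re_power by blast
    define d where "d j = (if j = k then c k * b / 2 else 0) + (if j = k + \<mu> then e else 0)" for j
    have \<mu>: "k + \<mu> \<noteq> 0" using m n k by (auto simp: \<mu>_def)
    have deg: "k \<le> (m + n) div 2" "k + \<mu> \<le> (m + n) div 2"
      "m + n - 2 * k = m - 2 * k + n" "m + n - 2 * (k + \<mu>) = m - 2 * k + n - 2 * \<mu>"
      using k by (auto simp: \<mu>_def)
    have "?t k x * Re (b * to_complex x ^ n)
        = (\<Sum>j\<le>(m + n) div 2. sqnorm x ^ j * Re (d j * to_complex x ^ (m + n - 2 * j)))" for x
    proof -
      let ?g = "\<lambda>a j. sqnorm x ^ j * Re (a * to_complex x ^ (m + n - 2 * j))"
      have add: "?g (a + a') j = ?g a j + ?g a' j" for a a' j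
        by (simp only: distrib_left distrib_right plus_complex.sel)
      have "(\<Sum>j\<le>(m + n) div 2. ?g (d j) j)
          = (\<Sum>j\<le>(m + n) div 2. (if j = k then ?g (c k * b / 2) j else 0) + (if j = k + \<mu> then ?g e j else 0))"
        by (intro sum.cong refl) (simp only: d_def add, simp)
      also have "\<dots> = ?g (c k * b / 2) k + ?g e (k + \<mu>)"
        using deg(1,2) by (simp only: sum.distrib sum.delta finite_atMost atMost_iff if_True)
      also have "\<dots> = sqnorm x ^ k * (Re (c k * to_complex x ^ (m - 2 * k)) * Re (b * to_complex x ^ n))"
        unfolding e deg(3,4) by (simp only: power_add distrib_left mult.assoc)
      finally show ?thesis by (simp only: mult.assoc)
    qed
    then have "harm_expansion (m + n) (\<lambda>x. ?t k x * Re (b * to_complex x ^ n)) d"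
      by (simp add: harm_expansion_def)
    moreover have "d 0 = (if k = 0 then c 0 * b / 2 else 0)"
      using \<mu> by (auto simp: d_def)
    ultimately show ?thesis unfolding Q_def by blast
  qed
  then obtain D where "\<And>k. k \<le> m div 2 \<Longrightarrow> Q k (D k)" by metis
  then have D: "\<And>k. k \<le> m div 2 \<Longrightarrow>
      harm_expansion (m + n) (\<lambda>x. ?t k x * Re (b * to_complex x ^ n)) (D k)"
    and D0: "\<And>k. k \<le> m div 2 \<Longrightarrow> D k 0 = (if k = 0 then c 0 * b / 2 else 0)"
    by (auto simp only: Q_def)
  define d where "d j = (\<Sum>k\<le>m div 2. D k j)" for j
  have "f x * Re (b * to_complex x ^ n)
      = (\<Sum>j\<le>(m + n) div 2. sqnorm x ^ j * Re (d j * to_complex x ^ (m + n - 2 * j)))" for x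
  proof -
    have "f x * Re (b * to_complex x ^ n) = (\<Sum>k\<le>m div 2. ?t k x * Re (b * to_complex x ^ n))"
      using f by (simp only: harm_expansion_def sum_distrib_right)
    also have "\<dots> = (\<Sum>k\<le>m div 2. \<Sum>j\<le>(m + n) div 2.
        sqnorm x ^ j * Re (D k j * to_complex x ^ (m + n - 2 * j)))"
      using D by (intro sum.cong refl) (simp only: harm_expansion_def atMost_iff)
    also have "\<dots> = (\<Sum>j\<le>(m + n) div 2. \<Sum>k\<le>m div 2.
        sqnorm x ^ j * Re (D k j * to_complex x ^ (m + n - 2 * j)))"
      by (rule sum.swap)
    finally show ?thesis by (simp only: d_def sum_distrib_left sum_distrib_right Re_sum)
  qed
  then have "harm_expansion (m + n) (\<lambda>x. f x * Re (b * to_complex x ^ n)) d"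
    unfolding harm_expansion_def by blast
  moreover have "d 0 = c 0 * b / 2" using D0 by (simp add: d_def)
  ultimately show ?thesis by blast
qed

text \<open>
  On the line \<open>x = 1\<close> a homogeneous polynomial becomes a polynomial in one variable, which can be
  evaluated at complex numbers; the point \<open>\<i>\<close>, a zero of \<open>q = 1 + t\<^sup>2\<close>, is the one of interest.
\<close>

lemma hom_poly_line:
  assumes "f \<in> hom_polys n"
  obtains P :: "complex poly" where "\<And>t. complex_of_real (f (vector [1, t])) = poly P (of_real t)"
proof -
  obtain c where c: "\<And>x. f x = (\<Sum>i\<le>n. c i * (x $ 1) ^ i * (x $ 2) ^ (n - i))"
    using assms by (auto simp: hom_polys_def)
  show ?thesis
    by (rule that[of "\<Sum>i\<le>n. monom (of_real (c i)) (n - i)"])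
       (simp add: c poly_sum poly_monom)
qed

lemma leading_part_mod_sqnorm:
  assumes "harm_decomp n f h"
  obtains P :: "complex poly" where
    "\<And>t. complex_of_real (f (vector [1, t]) - h 0 (vector [1, t])) = (1 + (of_real t)\<^sup>2) * poly P (of_real t)"
proof -
  have "\<exists>P. \<forall>t. complex_of_real (h k (vector [1, t])) = poly P (of_real t)" if "k \<le> n div 2" for k
  proof -
    have "h k \<in> hom_polys (n - 2 * k)"
      using assms that by (simp add: harm_decomp_def harm_polys_def)
    then obtain P where "\<And>t. complex_of_real (h k (vector [1, t])) = poly P (of_real t)"
      using hom_poly_line by blast
    then show ?thesis by blast
  qed
  then obtain Q where Q:
    "\<And>k t. k \<le> n div 2 \<Longrightarrow> complex_of_real (h k (vector [1, t])) = poly (Q k) (of_real t)"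
    by metis
  define P where "P = (\<Sum>k\<in>{1..n div 2}. [:1, 0, 1:] ^ (k - 1) * Q k)"
  have "complex_of_real (f (vector [1, t]) - h 0 (vector [1, t]))
      = (1 + (of_real t)\<^sup>2) * poly P (of_real t)" for t
  proof -
    have "f (vector [1, t]) = (\<Sum>k\<le>n div 2. (1 + t\<^sup>2) ^ k * h k (vector [1, t]))"
      using assms by (simp add: harm_decomp_def)
    also have "{..n div 2} = insert 0 {1..n div 2}" by auto
    finally have "f (vector [1, t]) - h 0 (vector [1, t])
        = (\<Sum>k\<in>{1..n div 2}. (1 + t\<^sup>2) ^ k * h k (vector [1, t]))" by simp
    also have "\<dots> = (\<Sum>k\<in>{1..n div 2}. (1 + t\<^sup>2) * ((1 + t\<^sup>2) ^ (k - 1) * h k (vector [1, t])))"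
    proof (intro sum.cong refl)
      fix k assume "k \<in> {1..n div 2}"
      then have "(1 + t\<^sup>2) ^ k = (1 + t\<^sup>2) * (1 + t\<^sup>2) ^ (k - 1)"
        by (cases k) auto
      then show "(1 + t\<^sup>2) ^ k * h k (vector [1, t])
          = (1 + t\<^sup>2) * ((1 + t\<^sup>2) ^ (k - 1) * h k (vector [1, t]))" by simp
    qed
    finally show ?thesis
      by (simp add: P_def poly_sum sum_distrib_left Q power2_eq_square)
  qed
  then show ?thesis by (rule that)
qed

text \<open>
  The difference of the two leading parts is a multiple of \<open>1 + t\<^sup>2\<close> on the line \<open>x = 1\<close>. The
  identity holds for the infinitely many real \<open>t\<close>, hence also at \<open>t = \<i>\<close>.
\<close>

lemma leading_coeff_unique:
  assumes h: "harm_decomp n f h" "h 0 = (\<lambda>x. Re (c * to_complex x ^ n))"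
    and g: "harm_decomp n f g" "g 0 = (\<lambda>x. Re (d * to_complex x ^ n))"
    and n: "1 \<le> n"
  shows "c = d"
proof -
  obtain P where P: "\<And>t. complex_of_real (f (vector [1, t]) - h 0 (vector [1, t]))
      = (1 + (of_real t)\<^sup>2) * poly P (of_real t)"
    using leading_part_mod_sqnorm[OF h(1)] by blast
  obtain Q where Q: "\<And>t. complex_of_real (f (vector [1, t]) - g 0 (vector [1, t]))
      = (1 + (of_real t)\<^sup>2) * poly Q (of_real t)"
    using leading_part_mod_sqnorm[OF g(1)] by blast
  define a where "a = c - d"
  \<comment> \<open>\<open>L\<close> extends \<open>Re (a * (1 + \<i> * t) ^ n)\<close> from real to complex \<open>t\<close>.\<close>
  define L where "L = smult (a / 2) ([:1, \<i>:] ^ n) + smult (cnj a / 2) ([:1, -\<i>:] ^ n)"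
  have "poly L (of_real t) = poly ([:1, 0, 1:] * (Q - P)) (of_real t)" for t
  proof -
    let ?w = "1 + \<i> * of_real t"
    have w: "to_complex (vector [1, t]) = ?w"
      by (simp add: to_complex_def complex_eq_iff)
    have "of_real (2 * Re (a * ?w ^ n)) = a * ?w ^ n + cnj (a * ?w ^ n)"
      by (rule complex_add_cnj[symmetric])
    then have "poly L (of_real t) = of_real (Re (a * ?w ^ n))"
      by (simp add: L_def field_simps)
    also have "Re (a * ?w ^ n) = (f (vector [1, t]) - g 0 (vector [1, t])) - (f (vector [1, t]) - h 0 (vector [1, t]))"
      by (simp add: h g w a_def algebra_simps)
    also have "complex_of_real \<dots> = poly ([:1, 0, 1:] * (Q - P)) (of_real t)"
      unfolding of_real_diff[of "_ - _" "_ - _"] P Q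
      by (simp add: algebra_simps power2_eq_square)
    finally show ?thesis .
  qed
  then have "range complex_of_real \<subseteq> {s. poly (L - [:1, 0, 1:] * (Q - P)) s = 0}"
    by auto
  moreover have "infinite (range complex_of_real)"
    by (simp add: finite_image_iff inj_of_real infinite_UNIV_char_0)
  ultimately have "L - [:1, 0, 1:] * (Q - P) = 0"
    using poly_roots_finite finite_subset by blast
  then have "poly L \<i> = poly ([:1, 0, 1:] * (Q - P)) \<i>" by simp
  moreover have "poly ([:1, 0, 1:] * (Q - P)) \<i> = 0" by simp
  moreover have "poly L \<i> = cnj a / 2 * 2 ^ n" using n by (simp add: L_def power_0_left)
  ultimately show ?thesis by (simp add: a_def)
qed

lemma leading_harm_of_expansion:
  assumes "harm_expansion n (phi S) c" "1 \<le> n"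
  shows "leading_harm n S = harm_form n (c 0)"
  unfolding leading_harm_def
proof (rule the_equality)
  let ?h = "\<lambda>k x. Re (c k * to_complex x ^ (n - 2 * k))"
  have h: "harm_decomp n (phi S) ?h" by (rule harm_decomp_of_expansion[OF assms(1)])
  then show "harm_form n (c 0) \<in> harm_tensors n
      \<and> (\<exists>h. harm_decomp n (phi S) h \<and> phi (harm_form n (c 0)) = h 0)"
    by (auto simp: harm_form_harm fun_eq_iff phi_harm_form intro!: exI[of _ ?h])
  fix T assume T: "T \<in> harm_tensors n \<and> (\<exists>h. harm_decomp n (phi S) h \<and> phi T = h 0)"
  then obtain d where d: "T = harm_form n d" using harm_tensor_is_harm_form assms(2) by blast
  obtain g where g: "harm_decomp n (phi S) g" "phi T = g 0" using T by blast
  have "g 0 = (\<lambda>x. Re (d * to_complex x ^ n))" by (simp add: d phi_harm_form fun_eq_iff flip: g(2))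
  then have "d = c 0" using leading_coeff_unique[OF g(1) _ h _ assms(2)] by simp
  then show "T = harm_form n (c 0)" using d by simp
qed

section \<open>The symmetrized product of harmonic tensors\<close>

lemma phi_sym_prod: "phi (sym_prod m n S T) x = phi S x * phi T x"
  by (simp add: phi_def sym_prod_def symmetrize_def tensor_prod_def o_def card_permutations)

lemma sym_prods_expansion:
  fixes z :: "nat \<Rightarrow> complex"
  assumes "1 \<le> p"
    and "\<And>j. j \<in> {1..p} \<Longrightarrow> 1 \<le> n j"
    and "\<And>j x. j \<in> {1..p} \<Longrightarrow> phi (H j) x = Re (cnj (z j) * to_complex x ^ n j)"
  shows "\<exists>c. harm_expansion (\<Sum>j=1..p. n j) (phi (sym_prods n H p)) c
           \<and> c 0 = (\<Prod>j=1..p. cnj (z j)) / 2 ^ (p - 1)"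
  using assms
proof (induction p rule: nat_induct_at_least)
  case base
  define c where "c k = (if k = 0 then cnj (z 1) else 0)" for k :: nat
  have "(\<Sum>k\<le>n 1 div 2. sqnorm x ^ k * Re (c k * to_complex x ^ (n 1 - 2 * k)))
      = (\<Sum>k\<le>n 1 div 2. if k = 0 then Re (cnj (z 1) * to_complex x ^ n 1) else 0)" for x
    by (intro sum.cong refl) (simp add: c_def)
  then have "harm_expansion (n 1) (phi (H 1)) c"
    using base by (simp add: harm_expansion_def)
  then show ?case by (auto intro!: exI[of _ c] simp: c_def)
next
  case (Suc p)
  define m where "m = (\<Sum>j=1..p. n j)"
  obtain c where c: "harm_expansion m (phi (sym_prods n H p)) c"
    and c0: "c 0 = (\<Prod>j=1..p. cnj (z j)) / 2 ^ (p - 1)"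
    using Suc unfolding m_def by auto
  have "n 1 \<le> m" unfolding m_def using Suc.hyps by (intro member_le_sum) auto
  then have "1 \<le> m" using Suc.prems(1)[of 1] by simp
  moreover have "1 \<le> n (Suc p)" using Suc.prems(1)[of "Suc p"] by simp
  ultimately obtain d where
    d: "harm_expansion (m + n (Suc p))
          (\<lambda>x. phi (sym_prods n H p) x * Re (cnj (z (Suc p)) * to_complex x ^ n (Suc p))) d"
    and d0: "d 0 = c 0 * cnj (z (Suc p)) / 2"
    using harm_expansion_mult[OF c] by blast
  obtain k where k: "p = Suc k" using Suc.hyps by (cases p) auto
  have "phi (sym_prods n H (Suc p))
      = (\<lambda>x. phi (sym_prods n H p) x * Re (cnj (z (Suc p)) * to_complex x ^ n (Suc p)))"
    using Suc.prems(2)[of "Suc p"] by (auto simp: k phi_sym_prod)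
  moreover have "d 0 = (\<Prod>j=1..Suc p. cnj (z j)) / 2 ^ (Suc p - 1)"
    by (simp add: d0 c0 k)
  ultimately show ?case using d by (auto simp: m_def)
qed

theorem theorem7p3:
  fixes p :: nat and n :: "nat \<Rightarrow> nat" and H :: "nat \<Rightarrow> tensor" and z :: "nat \<Rightarrow> complex"
  assumes "1 \<le> p"
    and "\<And>j. j \<in> {1..p} \<Longrightarrow> 1 \<le> n j"
    and "\<And>j. j \<in> {1..p} \<Longrightarrow> H j \<in> harm_tensors (n j)"
    and "\<And>j x. j \<in> {1..p} \<Longrightarrow>
           phi (H j) x = Re (cnj (z j) * Complex (x $ 1) (x $ 2) ^ n j)"
  shows "\<forall>x. Re ((\<Prod>j=1..p. cnj (z j)) * Complex (x $ 1) (x $ 2) ^ (\<Sum>j=1..p. n j))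
           = 2 ^ (p - 1) * phi (leading_harm (\<Sum>j=1..p. n j) (sym_prods n H p)) x"
proof
  fix x :: "real^2"
  let ?N = "\<Sum>j=1..p. n j" and ?w = "\<Prod>j=1..p. cnj (z j)"
  have "n 1 \<le> ?N" using assms(1) by (intro member_le_sum) auto
  then have N: "1 \<le> ?N" using assms(1) assms(2)[of 1] by simp
  obtain c where c: "harm_expansion ?N (phi (sym_prods n H p)) c" and c0: "c 0 = ?w / 2 ^ (p - 1)"
    using sym_prods_expansion[of p n H z] assms(1,2,4) by (auto simp: to_complex_def)
  have "?w * to_complex x ^ ?N = of_real (2 ^ (p - 1)) * (c 0 * to_complex x ^ ?N)"
    by (simp add: c0)
  then have "Re (?w * to_complex x ^ ?N) = 2 ^ (p - 1) * Re (c 0 * to_complex x ^ ?N)"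
    by (simp only: Re_of_real_mult)
  then show "Re (?w * Complex (x $ 1) (x $ 2) ^ ?N)
      = 2 ^ (p - 1) * phi (leading_harm ?N (sym_prods n H p)) x"
    unfolding leading_harm_of_expansion[OF c N] phi_harm_form by (simp add: to_complex_def)
qed

end
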